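(* Let $d\ge1$, and let $\mu: t \mapsto \mu_{t}\in\mathbb{R}^d$ and $\Sigma: t \mapsto \Sigma_{t}$ be smooth curves defined on an interval containing $0$, with $\Sigma_t$ symmetric positive definite of size $d\times d$. Then $t\mapsto \mathcal{N} (\mu_{t}, \Sigma_{t})$ is a geodesic of $\mathbb{G}_d$ if and only if $\mu$ and $\Sigma$ satisfy the equations $$\dot{\mu}_{t} = \Sigma_{t} J_{\mu},$$ $$\dot{\Sigma}_{t} = \Sigma_{t} (J_{\Sigma} - J_{\mu}\, \mu_{t}^{T})= \Sigma_{t} J_{\Sigma} - \dot{\mu}_{t}\, \mu_{t}^{T},$$ where $$J_{\mu} = \Sigma_{0}^{-1} \dot{\mu}_{0}\qquad\text{and}\qquad J_{\Sigma} = \Sigma_{0}^{-1} \left( \dot{\mu}_{0}\, \mu_{0}^{T}+\dot{\Sigma}_{0} \right).$$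
   Context: $\mathbb{G}_d$ is the manifold of (nondegenerate) Gaussian distributions $\mathcal N(\mu,\Sigma)$ on $\mathbb{R}^d$, with global coordinates $(\mu,\Sigma)$, $\mu\in\mathbb{R}^d$ (column vector), $\Sigma$ a real symmetric positive definite $d\times d$ matrix. It is equipped with the Fisher metric, for which the squared norm of a tangent vector $(\dot\mu,\dot\Sigma)$ ($\dot\mu\in\mathbb{R}^d$, $\dot\Sigma$ symmetric) at $\mathcal N(\mu,\Sigma)$ is $$\dot\mu^{T}\Sigma^{-1}\dot\mu+\tfrac12\operatorname{tr}(\dot\Sigma\Sigma^{-1}\dot\Sigma\Sigma^{-1}).$$ Geodesics are the usual (constant speed, possibly constant) Riemannian geodesics, i.e. critical curves of the energy functional $\int g(\dot\gamma,\dot\gamma)\,dt$ with fixed endpoints on every compact subinterval. A dot denotes the derivative in $t$; $\dot\mu_0,\dot\Sigma_0$ are the derivatives at $t=0$. *)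

theory Defs
  imports "HOL-Analysis.Analysis"
begin

(* Derivatives are taken within S, so they are one-sided at boundary points of S. The
   definitions are meant for sets on which such derivatives are unique, such as convex sets
   with nonempty interior (nondegenerate intervals, rectangles). *)
primrec Ck_on :: "nat \<Rightarrow> 'a::real_normed_vector set \<Rightarrow> ('a \<Rightarrow> 'b::real_normed_vector) \<Rightarrow> bool"
  where
    "Ck_on 0 S f \<longleftrightarrow> continuous_on S f"
  | "Ck_on (Suc k) S f \<longleftrightarrow>
       (\<exists>f'. (\<forall>x\<in>S. (f has_derivative f' x) (at x within S)) \<and>
             (\<forall>v. Ck_on k S (\<lambda>x. f' x v)))"

definition smooth_on :: "'a::real_normed_vector set \<Rightarrow> ('a \<Rightarrow> 'b::real_normed_vector) \<Rightarrow> bool"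
  where "smooth_on S f \<longleftrightarrow> (\<forall>k. Ck_on k S f)"


(* A Riemannian manifold with a global chart is given by the image M of the chart, a subset of
   a normed space, and the function G with G p v the squared norm of the tangent vector v at p. *)

definition energy ::
    "('a::real_normed_vector \<Rightarrow> 'a \<Rightarrow> real) \<Rightarrow> real \<Rightarrow> real \<Rightarrow> (real \<Rightarrow> 'a) \<Rightarrow> real"
  where "energy G a b \<gamma> =
    integral {a..b} (\<lambda>t. G (\<gamma> t) (vector_derivative \<gamma> (at t within {a..b})))"

definition proper_variation ::
    "'a::real_normed_vector set \<Rightarrow> real \<Rightarrow> real \<Rightarrow> (real \<Rightarrow> 'a) \<Rightarrow> real \<Rightarrow> (real \<times> real \<Rightarrow> 'a) \<Rightarrow> bool"
  where "proper_variation M a b \<gamma> \<epsilon> \<Gamma> \<longleftrightarrow>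
    smooth_on ({-\<epsilon><..<\<epsilon>} \<times> {a..b}) \<Gamma> \<and>
    \<Gamma> ` ({-\<epsilon><..<\<epsilon>} \<times> {a..b}) \<subseteq> M \<and>
    (\<forall>t\<in>{a..b}. \<Gamma> (0, t) = \<gamma> t) \<and>
    (\<forall>s\<in>{-\<epsilon><..<\<epsilon>}. \<Gamma> (s, a) = \<gamma> a \<and> \<Gamma> (s, b) = \<gamma> b)"

definition energy_critical ::
    "'a::real_normed_vector set \<Rightarrow> ('a \<Rightarrow> 'a \<Rightarrow> real) \<Rightarrow> real \<Rightarrow> real \<Rightarrow> (real \<Rightarrow> 'a) \<Rightarrow> bool"
  where "energy_critical M G a b \<gamma> \<longleftrightarrow>
    (\<forall>\<epsilon>>0. \<forall>\<Gamma>. proper_variation M a b \<gamma> \<epsilon> \<Gamma> \<longrightarrow>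
      ((\<lambda>s. energy G a b (\<lambda>t. \<Gamma> (s, t))) has_real_derivative 0) (at 0))"

definition geodesic_on ::
    "'a::real_normed_vector set \<Rightarrow> ('a \<Rightarrow> 'a \<Rightarrow> real) \<Rightarrow> real set \<Rightarrow> (real \<Rightarrow> 'a) \<Rightarrow> bool"
  where "geodesic_on M G I \<gamma> \<longleftrightarrow>
    smooth_on I \<gamma> \<and> \<gamma> ` I \<subseteq> M \<and>
    (\<forall>a b. a < b \<and> {a..b} \<subseteq> I \<longrightarrow> energy_critical M G a b \<gamma>)"


definition sym_posdef :: "real^'d^'d \<Rightarrow> bool"
  where "sym_posdef A \<longleftrightarrow> transpose A = A \<and> (\<forall>x. x \<noteq> 0 \<longrightarrow> 0 < x \<bullet> (A *v x))"

(* The nondegenerate Gaussian distribution with mean m and covariance matrix A is represented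
   by its global coordinates (m, A). *)
definition gaussian_manifold :: "((real^'d) \<times> (real^'d^'d)) set"
  where "gaussian_manifold = {(m, A). sym_posdef A}"

definition fisher_sqnorm :: "(real^'d) \<times> (real^'d^'d) \<Rightarrow> (real^'d) \<times> (real^'d^'d) \<Rightarrow> real"
  where "fisher_sqnorm p v = (case (p, v) of ((m, A), (u, B)) \<Rightarrow>
    u \<bullet> (matrix_inv A *v u) + 1/2 * trace (B ** matrix_inv A ** B ** matrix_inv A))"

(* The matrix u v\<^sup>T for column vectors u, v. *)
definition outer_prod :: "real^'d \<Rightarrow> real^'d \<Rightarrow> real^'d^'d"
  where "outer_prod u v = (\<chi> i j. u $ i * v $ j)"

end

theory Submission
  imports Defs
begin

text \<open>
  Write \<open>P = \<Sigma>\<^sup>-\<^sup>1 \<mu>'\<close> and \<open>Q = \<Sigma>\<^sup>-\<^sup>1 \<Sigma>' \<Sigma>\<^sup>-\<^sup>1\<close> for the momenta conjugate to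
  the mean and to the covariance. Differentiating the energy of a proper variation under the integral
  sign and integrating by parts gives (lemma \<open>first_variation\<close>), for a variation field \<open>(e, B)\<close>,
  the derivative \<open>- \<integral> 2 (e \<bullet> P') + tr (B W)\<close> with \<open>W = Q' + Q \<Sigma> Q + P P\<^sup>T\<close>.
  So a curve with \<open>P' = 0\<close> and \<open>W = 0\<close> is a geodesic. Conversely, every field
  \<open>(t - a) (b - t) (e, B)\<close> with \<open>e\<close> and a symmetric \<open>B\<close> constant is the field of an admissible
  variation over \<open>[a, b]\<close>, because positive definiteness is an open condition. A geodesic is critical on
  \<^emph>\<open>every\<close> interval \<open>[a, b]\<close>, so these weights can be concentrated around any given time, and they
  suffice to conclude that \<open>P' = 0\<close> and \<open>W = 0\<close> (lemma \<open>geodesic_iff_Euler_Lagrange\<close>).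

  These second order equations integrate once because the affine group of \<open>\<real>\<^sup>d\<close> acts by
  isometries: \<open>P\<close> is the Noether momentum of the translations, and
  \<open>K = \<Sigma>\<^sup>-\<^sup>1 \<Sigma>' + P \<mu>\<^sup>T\<close> that of the linear maps. Indeed \<open>K' = W \<Sigma> + P' \<mu>\<^sup>T\<close>, so the
  Euler--Lagrange equations say exactly that \<open>P\<close> and \<open>K\<close> are constant
  (lemma \<open>Euler_Lagrange_iff_first_order\<close>). The constants are \<open>J\<^sub>\<mu>\<close> and \<open>J\<^sub>\<Sigma>\<close>, and
  solving \<open>P = J\<^sub>\<mu>\<close> and \<open>K = J\<^sub>\<Sigma>\<close> for \<open>\<mu>'\<close> and \<open>\<Sigma>'\<close> gives the first order system.
\<close>

section \<open>Matrix calculus\<close>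

lemma matrix_inv_works:
  fixes A :: "real^'n^'n"
  assumes "invertible A"
  shows "A ** matrix_inv A = mat 1" "matrix_inv A ** A = mat 1"
  using someI_ex[OF assms[unfolded invertible_def]] by (simp_all add: matrix_inv_def)

lemma matrix_inv_unique:
  fixes A :: "real^'n^'n"
  assumes "A ** B = mat 1"
  shows "matrix_inv A = B"
proof -
  have "invertible A" using assms by (meson invertible_right_inverse)
  then show ?thesis
    by (metis assms matrix_inv_works(2) matrix_mul_assoc matrix_mul_lid matrix_mul_rid)
qed

lemma continuous_on_det:
  "continuous_on S (\<lambda>x. det (f x :: real^'n^'n))" if "continuous_on S f"
  unfolding det_def using that by (intro continuous_intros)

text \<open>By Cramer's rule the entries of the inverse are quotients of determinants.\<close>

lemma continuous_on_matrix_inv: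
  fixes f :: "'a::topological_space \<Rightarrow> real^'n^'n"
  assumes f: "continuous_on S f" and inv: "\<And>x. x \<in> S \<Longrightarrow> invertible (f x)"
  shows "continuous_on S (\<lambda>x. matrix_inv (f x))"
proof -
  define C where "C x i j = det (\<chi> p q. if q = i then axis j 1 $ p else f x $ p $ q) / det (f x)" for x i j
  have det: "det (f x) \<noteq> 0" if "x \<in> S" for x
    using inv[OF that] by (simp add: invertible_det_nz)
  have "matrix_inv (f x) = (\<chi> i j. C x i j)" if "x \<in> S" for x
  proof -
    have "f x *v column j (matrix_inv (f x)) = axis j 1" for j
      by (metis inv that column_def matrix_inv_works(1) matrix_vector_mul_assoc matrix_vector_mul_lid matrix_vector_mult_basis)
    then have "column j (matrix_inv (f x)) = (\<chi> i. C x i j)" for j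
      unfolding C_def using cramer[OF det[OF that]] by blast
    then show ?thesis by (simp add: vec_eq_iff column_def)
  qed
  moreover have "continuous_on S (\<lambda>x. \<chi> i j. C x i j)"
  proof -
    have "continuous_on S (\<lambda>x. (if q = i then axis j 1 $ p else f x $ p $ q))" for p q i and j :: 'n
      using f by (cases "q = i") (auto intro!: continuous_intros)
    then show ?thesis unfolding C_def
      by (intro continuous_on_vec_lambda continuous_on_divide continuous_on_det f ballI det)
  qed
  ultimately show ?thesis by (simp cong: continuous_on_cong)
qed

lemma bounded_bilinear_matrix_matrix_mult: "bounded_bilinear ((**) :: real^'n^'m \<Rightarrow> real^'p^'n \<Rightarrow> real^'p^'m)"
  unfolding bilinear_conv_bounded_bilinear[symmetric] bilinear_def
  by (auto intro!: linearI simp: vec_eq_iff matrix_matrix_mult_def algebra_simps sum.distrib sum_distrib_left)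

lemma bounded_bilinear_matrix_vector_mult: "bounded_bilinear ((*v) :: real^'n^'m \<Rightarrow> real^'n \<Rightarrow> real^'m)"
  unfolding bilinear_conv_bounded_bilinear[symmetric] bilinear_def
  by (auto intro!: linearI simp: vec_eq_iff matrix_vector_mult_def algebra_simps sum.distrib sum_distrib_left)

lemma bounded_bilinear_outer_prod: "bounded_bilinear (outer_prod :: real^'n \<Rightarrow> real^'n \<Rightarrow> real^'n^'n)"
  unfolding bilinear_conv_bounded_bilinear[symmetric] bilinear_def
  by (auto intro!: linearI simp: vec_eq_iff outer_prod_def algebra_simps sum.distrib sum_distrib_left)

lemma bounded_linear_trace: "bounded_linear (trace :: real^'n^'n \<Rightarrow> real)"
  unfolding linear_conv_bounded_linear[symmetric]
  by (auto intro!: linearI simp: trace_def algebra_simps sum.distrib sum_distrib_left)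

lemma bounded_linear_transpose: "bounded_linear (transpose :: real^'n^'m \<Rightarrow> real^'m^'n)"
  unfolding linear_conv_bounded_linear[symmetric]
  by (auto intro!: linearI simp: transpose_def vec_eq_iff)

lemma has_vector_derivative_iff_quotient:
  "(f has_vector_derivative D) (at x within S) \<longleftrightarrow>
    ((\<lambda>y. (f y - f x) /\<^sub>R (y - x)) \<longlongrightarrow> D) (at x within S)"
proof -
  have eq: "norm (f y - f x - (y - x) *\<^sub>R D) / norm (y - x) = norm ((f y - f x) /\<^sub>R (y - x) - D)"
    if "y \<noteq> x" for y
  proof -
    have "f y - f x - (y - x) *\<^sub>R D = (y - x) *\<^sub>R ((f y - f x) /\<^sub>R (y - x) - D)"
      using that by (simp add: scaleR_diff_right)
    then show ?thesis using that by simp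
  qed
  have "(f has_vector_derivative D) (at x within S) \<longleftrightarrow>
     ((\<lambda>y. norm (f y - f x - (y - x) *\<^sub>R D) / norm (y - x)) \<longlongrightarrow> 0) (at x within S)"
    unfolding has_vector_derivative_def has_derivative_iff_norm by (simp add: bounded_linear_scaleR_left)
  also have "\<dots> \<longleftrightarrow> ((\<lambda>y. norm ((f y - f x) /\<^sub>R (y - x) - D)) \<longlongrightarrow> 0) (at x within S)"
    using eq by (intro filterlim_cong) (auto simp: eventually_at_filter)
  finally show ?thesis by (simp only: tendsto_norm_zero_iff LIM_zero_iff)
qed

text \<open>The difference quotient is handled directly, by
  \<open>B\<^sup>-\<^sup>1 - A\<^sup>-\<^sup>1 = - B\<^sup>-\<^sup>1 (B - A) A\<^sup>-\<^sup>1\<close> and the continuity of inversion.\<close>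

lemma has_vector_derivative_matrix_inv:
  fixes f :: "real \<Rightarrow> real^'n^'n"
  assumes f: "(f has_vector_derivative f') (at x within S)"
    and "x \<in> S" and inv: "\<And>y. y \<in> S \<Longrightarrow> invertible (f y)"
    and cf: "continuous_on S f"
  shows "((\<lambda>y. matrix_inv (f y)) has_vector_derivative - (matrix_inv (f x) ** f' ** matrix_inv (f x)))
    (at x within S)"
proof -
  let ?X = "\<lambda>y. matrix_inv (f y)"
  interpret mm: bounded_bilinear "(**) :: real^'n^'n \<Rightarrow> real^'n^'n \<Rightarrow> real^'n^'n"
    by (rule bounded_bilinear_matrix_matrix_mult)
  have "(?X \<longlongrightarrow> ?X x) (at x within S)"
    using continuous_on_matrix_inv[OF cf inv] \<open>x \<in> S\<close> by (simp add: continuous_on_def)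
  moreover have "((\<lambda>y. (f y - f x) /\<^sub>R (y - x)) \<longlongrightarrow> f') (at x within S)"
    using f by (simp add: has_vector_derivative_iff_quotient)
  ultimately have "((\<lambda>y. - (?X y ** ((f y - f x) /\<^sub>R (y - x)) ** ?X x)) \<longlongrightarrow> - (?X x ** f' ** ?X x)) (at x within S)"
    by (intro tendsto_minus mm.tendsto tendsto_const)
  moreover have "- (?X y ** ((f y - f x) /\<^sub>R (y - x)) ** ?X x) = (?X y - ?X x) /\<^sub>R (y - x)" if "y \<in> S" for y
  proof -
    have "?X y ** (f y - f x) ** ?X x = ?X x - ?X y"
      by (simp add: mm.diff_left mm.diff_right matrix_inv_works inv that \<open>x \<in> S\<close> flip: matrix_mul_assoc)
    then show ?thesis
      by (simp only: mm.scaleR_left mm.scaleR_right minus_diff_eq flip: scaleR_minus_right)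
  qed
  ultimately show ?thesis unfolding has_vector_derivative_iff_quotient
    by (elim Lim_transform_eventually) (auto simp: eventually_at_filter intro!: always_eventually)
qed

lemma sym_posdef_invertible: "sym_posdef A \<Longrightarrow> invertible A"
  unfolding invertible_left_inverse matrix_left_invertible_ker sym_posdef_def by fastforce

lemma transpose_matrix_inv:
  assumes "sym_posdef A"
  shows "transpose (matrix_inv A) = matrix_inv A"
proof (rule matrix_inv_unique[symmetric])
  have "transpose (matrix_inv A ** A) = mat 1"
    by (simp add: matrix_inv_works sym_posdef_invertible assms)
  then show "A ** transpose (matrix_inv A) = mat 1"
    using assms by (simp add: matrix_transpose_mul sym_posdef_def)
qed

lemma inner_symmetric_mult:
  fixes X :: "real^'n^'n"
  assumes "transpose X = X" shows "u \<bullet> (X *v v) = (X *v u) \<bullet> v"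
  by (metis assms dot_lmul_matrix transpose_matrix_vector)

lemma trace_mult_outer_prod: "trace (A ** outer_prod u v) = v \<bullet> (A *v u)"
  by (simp add: trace_def matrix_matrix_mult_def outer_prod_def inner_vec_def matrix_vector_mult_def
      sum_distrib_left mult_ac)

lemma mult_outer_prod: "A ** outer_prod u v = outer_prod (A *v u) v"
  by (simp add: vec_eq_iff matrix_matrix_mult_def outer_prod_def matrix_vector_mult_def sum_distrib_left sum_distrib_right mult_ac)

lemma outer_prod_mult: "outer_prod u v ** A = outer_prod u (v v* A)"
  by (simp add: vec_eq_iff matrix_matrix_mult_def outer_prod_def vector_matrix_mult_def sum_distrib_left mult_ac)

lemma transpose_outer_prod: "transpose (outer_prod u v) = outer_prod v u"
  by (simp add: vec_eq_iff transpose_def outer_prod_def mult_ac)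

lemma transpose_add: "transpose (A + B) = transpose A + transpose (B :: real^'n^'m)"
  by (simp add: transpose_def vec_eq_iff)

lemma trace_mult_transpose: "trace (A ** transpose A) = A \<bullet> (A :: real^'n^'n)"
  by (simp add: trace_def matrix_matrix_mult_def transpose_def inner_vec_def)

section \<open>Maps of class $C^k$ and mixed partial derivatives\<close>

lemma Ck_on_imp_continuous_on: "Ck_on k S f \<Longrightarrow> continuous_on S f"
  by (cases k) (simp, metis has_derivative_continuous_on Ck_on.simps(2))

lemma Ck_on_SucD:
  assumes "Ck_on (Suc k) S f"
  shows "\<exists>f'. (\<forall>x\<in>S. (f has_derivative f' x) (at x within S)) \<and> (\<forall>v. Ck_on k S (\<lambda>x. f' x v))"
  using assms by simp

lemma Ck_on_Suc_imp: "Ck_on (Suc k) S f \<Longrightarrow> Ck_on k S f"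
proof (induction k arbitrary: f)
  case 0 then show ?case using Ck_on_imp_continuous_on[OF 0] by simp
next
  case (Suc k)
  then obtain f' where "\<forall>x\<in>S. (f has_derivative f' x) (at x within S)" "\<And>v. Ck_on (Suc k) S (\<lambda>x. f' x v)"
    by (metis Ck_on.simps(2))
  then show ?case using Suc.IH by auto
qed

lemma smooth_on_imp_Ck_on: "smooth_on S f \<Longrightarrow> Ck_on k S f"
  by (simp add: smooth_on_def)

lemma Ck_on_subset: "Ck_on k S f \<Longrightarrow> T \<subseteq> S \<Longrightarrow> Ck_on k T f"
proof (induction k arbitrary: f)
  case (Suc k)
  then show ?case by (auto intro: has_derivative_subset) (meson has_derivative_subset subsetD)
qed (auto intro: continuous_on_subset)

lemma Ck_on_const: "Ck_on k S (\<lambda>x. c)"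
proof (induction k arbitrary: c)
  case (Suc k)
  show ?case by (auto intro!: exI[of _ "\<lambda>x v. 0"] Suc)
qed auto

lemma Ck_on_linear: assumes "bounded_linear f" shows "Ck_on k S f"
proof (cases k)
  case (Suc k)
  then show ?thesis
    by (auto intro!: exI[of _ "\<lambda>x. f"] Ck_on_const bounded_linear_imp_has_derivative assms)
qed (use assms in \<open>auto intro: linear_continuous_on\<close>)

lemma Ck_on_compose_linear:
  assumes L: "bounded_linear L" and "Ck_on k T g" "L ` S \<subseteq> T"
  shows "Ck_on k S (\<lambda>x. g (L x))"
  using assms(2)
proof (induction k arbitrary: g)
  case 0
  then show ?case using assms continuous_on_compose2[of T g S L] linear_continuous_on[OF L] by auto
next
  case (Suc k)
  then obtain g' where g': "\<And>x. x\<in>T \<Longrightarrow> (g has_derivative g' x) (at x within T)" "\<And>v. Ck_on k T (\<lambda>x. g' x v)"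
    by auto
  have "((\<lambda>x. g (L x)) has_derivative (\<lambda>v. g' (L x) (L v))) (at x within S)" if "x \<in> S" for x
    using that assms(3) 
    by (intro has_derivative_in_compose2[of T g g' L S x L] g'(1) bounded_linear_imp_has_derivative L) auto
  then show ?case using Suc.IH[OF g'(2)] by (auto intro!: exI[of _ "\<lambda>x v. g' (L x) (L v)"])
qed

lemma Ck_on_add:
  assumes "Ck_on k S f" "Ck_on k S g"
  shows "Ck_on k S (\<lambda>x. f x + g x)"
  using assms
proof (induction k arbitrary: f g)
  case (Suc k)
  then obtain f' g' where
    "\<And>x. x\<in>S \<Longrightarrow> (f has_derivative f' x) (at x within S)" "\<And>v. Ck_on k S (\<lambda>x. f' x v)"
    "\<And>x. x\<in>S \<Longrightarrow> (g has_derivative g' x) (at x within S)" "\<And>v. Ck_on k S (\<lambda>x. g' x v)"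
    using Ck_on_SucD[OF Suc.prems(1)] Ck_on_SucD[OF Suc.prems(2)] by blast
  then show ?case using Suc.IH
    by (auto intro!: exI[of _ "\<lambda>x v. f' x v + g' x v"] has_derivative_add)
qed (auto intro: continuous_intros)

lemma Ck_on_bilinear:
  assumes p: "bounded_bilinear p" and "Ck_on k S f" "Ck_on k S g"
  shows "Ck_on k S (\<lambda>x. p (f x) (g x))"
  using assms(2,3)
proof (induction k arbitrary: f g)
  case 0
  then show ?case by (simp add: bounded_bilinear.continuous_on[OF p])
next
  case (Suc k)
  then obtain f' g' where
    "\<And>x. x\<in>S \<Longrightarrow> (f has_derivative f' x) (at x within S)" "\<And>v. Ck_on k S (\<lambda>x. f' x v)"
    "\<And>x. x\<in>S \<Longrightarrow> (g has_derivative g' x) (at x within S)" "\<And>v. Ck_on k S (\<lambda>x. g' x v)"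
    using Ck_on_SucD[OF Suc.prems(1)] Ck_on_SucD[OF Suc.prems(2)] by blast
  then show ?case using Suc.IH Ck_on_Suc_imp[OF Suc.prems(1)] Ck_on_Suc_imp[OF Suc.prems(2)]
    by (auto intro!: exI[of _ "\<lambda>x v. p (f x) (g' x v) + p (f' x v) (g x)"] bounded_bilinear.FDERIV[OF p] Ck_on_add)
qed

lemma Ck_on_Pair:
  assumes "Ck_on k S f" "Ck_on k S g"
  shows "Ck_on k S (\<lambda>x. (f x, g x))"
  using assms
proof (induction k arbitrary: f g)
  case (Suc k)
  then obtain f' g' where
    "\<And>x. x\<in>S \<Longrightarrow> (f has_derivative f' x) (at x within S)" "\<And>v. Ck_on k S (\<lambda>x. f' x v)"
    "\<And>x. x\<in>S \<Longrightarrow> (g has_derivative g' x) (at x within S)" "\<And>v. Ck_on k S (\<lambda>x. g' x v)"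
    using Ck_on_SucD[OF Suc.prems(1)] Ck_on_SucD[OF Suc.prems(2)] by blast
  then show ?case using Suc.IH
    by (auto intro!: exI[of _ "\<lambda>x v. (f' x v, g' x v)"] has_derivative_Pair)
qed (auto intro: continuous_intros)

lemma Ck_on_Suc_real_imp_vector_derivative:
  fixes f :: "real \<Rightarrow> 'b::real_normed_vector"
  assumes "Ck_on (Suc k) I f"
  shows "\<exists>f'. (\<forall>t\<in>I. (f has_vector_derivative f' t) (at t within I)) \<and> Ck_on k I f'"
proof -
  obtain D where D: "\<And>x. x \<in> I \<Longrightarrow> (f has_derivative D x) (at x within I)"
    "\<And>v. Ck_on k I (\<lambda>x. D x v)" using Ck_on_SucD[OF assms] by blast
  have lin: "D x = (\<lambda>h. h *\<^sub>R D x 1)" if "x \<in> I" for x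
  proof
    fix h :: real
    show "D x h = h *\<^sub>R D x 1"
      using linear_cmul[OF has_derivative_linear[OF D(1)[OF that]], of h 1] by simp
  qed
  show ?thesis
  proof (intro exI[of _ "\<lambda>t. D t 1"] conjI ballI D(2))
    show "(f has_vector_derivative D t 1) (at t within I)" if "t \<in> I" for t
      unfolding has_vector_derivative_def lin[OF that, symmetric] by (rule D(1)[OF that])
  qed
qed

text \<open>Symmetry of the mixed partial derivatives up to the boundary of a rectangle: differentiating
  \<open>\<Gamma>(s, t) - \<Gamma>(s, a) = \<integral> \<partial>\<^sub>t\<Gamma>(s, u) du\<close> in \<open>s\<close> under the integral sign
  expresses \<open>\<partial>\<^sub>s\<Gamma>\<close> as an integral in \<open>t\<close> of \<open>\<partial>\<^sub>s\<partial>\<^sub>t\<Gamma>\<close>, which is then differentiated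
  in \<open>t\<close>.\<close>

lemma mixed_partials_exchange:
  fixes \<Gamma> :: "real \<times> real \<Rightarrow> 'a::banach"
  assumes U: "convex U" "s \<in> U" and T: "t \<in> {a..b}"
  and nb: "\<And>s. s \<in> U \<Longrightarrow> at s within U \<noteq> bot"
  and ds: "\<And>s t. s \<in> U \<Longrightarrow> t \<in> {a..b} \<Longrightarrow> ((\<lambda>s. \<Gamma> (s, t)) has_vector_derivative \<Gamma>s (s, t)) (at s within U)"
  and dt: "\<And>s t. s \<in> U \<Longrightarrow> t \<in> {a..b} \<Longrightarrow> ((\<lambda>t. \<Gamma> (s, t)) has_vector_derivative \<Gamma>t (s, t)) (at t within {a..b})"
  and dst: "\<And>s t. s \<in> U \<Longrightarrow> t \<in> {a..b} \<Longrightarrow> ((\<lambda>s. \<Gamma>t (s, t)) has_vector_derivative \<Gamma>ts (s, t)) (at s within U)"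
  and ct: "continuous_on (U \<times> {a..b}) \<Gamma>t"
  and cts: "continuous_on (U \<times> {a..b}) \<Gamma>ts"
  shows "((\<lambda>t. \<Gamma>s (s, t)) has_vector_derivative \<Gamma>ts (s, t)) (at t within {a..b})"
proof -
  have sec: "continuous_on {a..c} (\<lambda>t. f (r, t))" if "continuous_on (U \<times> {a..b}) f" "r \<in> U" "c \<le> b"
    for f :: "real \<times> real \<Rightarrow> 'a" and r c
    by (rule continuous_on_compose2[OF that(1)]) (use that in \<open>auto intro!: continuous_intros\<close>)
  have eq: "\<Gamma>s (s, c) = \<Gamma>s (s, a) + integral {a..c} (\<lambda>u. \<Gamma>ts (s, u))" if c: "c \<in> {a..b}" for c
  proof -
    have "integral {a..c} (\<lambda>u. \<Gamma>t (r, u)) = \<Gamma> (r, c) - \<Gamma> (r, a)" if "r \<in> U" for r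
      using c that
      by (intro integral_unique fundamental_theorem_of_calculus has_vector_derivative_within_subset[OF dt]) auto
    moreover have "((\<lambda>r. integral (cbox a c) (\<lambda>u. \<Gamma>t (r, u))) has_vector_derivative
        integral (cbox a c) (\<lambda>u. \<Gamma>ts (s, u))) (at s within U)"
      using c sec[OF ct, of _ c]
      by (intro leibniz_rule_vector_derivative[of U a c "\<lambda>s t. \<Gamma>t (s,t)" "\<lambda>s t. \<Gamma>ts (s,t)"])
        (auto intro!: U dst integrable_continuous_real continuous_on_subset[OF cts])
    ultimately have "((\<lambda>r. \<Gamma> (r, c) - \<Gamma> (r, a)) has_vector_derivative integral {a..c} (\<lambda>u. \<Gamma>ts (s, u))) (at s within U)"
      using has_vector_derivative_transform[OF U(2), of "\<lambda>r. \<Gamma> (r, c) - \<Gamma> (r, a)" "\<lambda>r. integral (cbox a c) (\<lambda>u. \<Gamma>t (r, u))"] by simp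
    moreover have "((\<lambda>r. \<Gamma> (r, c) - \<Gamma> (r, a)) has_vector_derivative \<Gamma>s (s, c) - \<Gamma>s (s, a)) (at s within U)"
      using c U by (intro has_vector_derivative_diff ds) auto
    ultimately show ?thesis
      using vector_derivative_unique_within[OF nb[OF U(2)]] by (metis add.commute diff_add_cancel)
  qed
  have "((\<lambda>c. \<Gamma>s (s, a) + integral {a..c} (\<lambda>u. \<Gamma>ts (s, u))) has_vector_derivative 0 + \<Gamma>ts (s, t)) (at t within {a..b})"
    using sec[OF cts U(2), of b]
    by (intro has_vector_derivative_add has_vector_derivative_const integral_has_vector_derivative T) auto
  then show ?thesis
    using has_vector_derivative_transform[OF T eq] by simp
qed

text \<open>This form of $C^2$ regularity serves the calculus of variations: \<open>\<Gamma>t\<close> is the velocity of the varied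
  curves, \<open>\<Gamma>s\<close> the variation field, and \<open>\<Gamma>ts\<close> is both the derivative of the velocity in \<open>s\<close>
  (needed to differentiate the energy) and that of the variation field in \<open>t\<close> (needed to integrate by
  parts).\<close>

lemma C2_on_rectangle:
  fixes \<Gamma> :: "real \<times> real \<Rightarrow> 'a::banach"
  assumes "Ck_on 2 (U \<times> {a..b}) \<Gamma>" and U: "convex U" "\<And>s. s \<in> U \<Longrightarrow> at s within U \<noteq> bot"
  obtains \<Gamma>s \<Gamma>t \<Gamma>ts where
    "continuous_on (U \<times> {a..b}) \<Gamma>s" "continuous_on (U \<times> {a..b}) \<Gamma>t" "continuous_on (U \<times> {a..b}) \<Gamma>ts"
    "\<forall>s\<in>U. \<forall>t\<in>{a..b}. ((\<lambda>s. \<Gamma> (s, t)) has_vector_derivative \<Gamma>s (s, t)) (at s within U)"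
    "\<forall>s\<in>U. \<forall>t\<in>{a..b}. ((\<lambda>t. \<Gamma> (s, t)) has_vector_derivative \<Gamma>t (s, t)) (at t within {a..b})"
    "\<forall>s\<in>U. \<forall>t\<in>{a..b}. ((\<lambda>s. \<Gamma>t (s, t)) has_vector_derivative \<Gamma>ts (s, t)) (at s within U)"
    "\<forall>s\<in>U. \<forall>t\<in>{a..b}. ((\<lambda>t. \<Gamma>s (s, t)) has_vector_derivative \<Gamma>ts (s, t)) (at t within {a..b})"
proof -
  let ?S = "U \<times> {a..b}"
  have s: "((\<lambda>s. f (s, t)) has_vector_derivative D (s, t) (1, 0)) (at s within U)"
    and t: "((\<lambda>t. f (s, t)) has_vector_derivative D (s, t) (0, 1)) (at t within {a..b})"
    if D: "\<And>x. x \<in> ?S \<Longrightarrow> (f has_derivative D x) (at x within ?S)" and st: "s \<in> U" "t \<in> {a..b}"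
    for f :: "real \<times> real \<Rightarrow> 'a" and D s t
  proof -
    have lin: "linear (D (s, t))" using has_derivative_linear D st by blast
    have "((\<lambda>s. f (s, t)) has_derivative (\<lambda>h. D (s, t) (h, 0))) (at s within U)"
      using st by (intro has_derivative_in_compose2[of ?S f D "\<lambda>s. (s, t)" U s "\<lambda>h. (h, 0)"] D)
        (auto intro!: derivative_eq_intros)
    moreover have "(\<lambda>h. D (s, t) (h, 0)) = (\<lambda>h. h *\<^sub>R D (s, t) (1, 0))"
    proof
      fix h :: real
      show "D (s, t) (h, 0) = h *\<^sub>R D (s, t) (1, 0)" using linear_cmul[OF lin, of h "(1, 0)"] by simp
    qed
    ultimately show "((\<lambda>s. f (s, t)) has_vector_derivative D (s, t) (1, 0)) (at s within U)"
      by (simp only: has_vector_derivative_def)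
    have "((\<lambda>t. f (s, t)) has_derivative (\<lambda>h. D (s, t) (0, h))) (at t within {a..b})"
      using st by (intro has_derivative_in_compose2[of ?S f D "\<lambda>t. (s, t)" "{a..b}" t "\<lambda>h. (0, h)"] D)
        (auto intro!: derivative_eq_intros)
    moreover have "(\<lambda>h. D (s, t) (0, h)) = (\<lambda>h. h *\<^sub>R D (s, t) (0, 1))"
    proof
      fix h :: real
      show "D (s, t) (0, h) = h *\<^sub>R D (s, t) (0, 1)" using linear_cmul[OF lin, of h "(0, 1)"] by simp
    qed
    ultimately show "((\<lambda>t. f (s, t)) has_vector_derivative D (s, t) (0, 1)) (at t within {a..b})"
      by (simp only: has_vector_derivative_def)
  qed
  have "Ck_on (Suc (Suc 0)) ?S \<Gamma>" using assms(1) by (simp add: numeral_2_eq_2)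
  from Ck_on_SucD[OF this] obtain D where D: "\<And>x. x \<in> ?S \<Longrightarrow> (\<Gamma> has_derivative D x) (at x within ?S)"
    and D1: "\<And>v. Ck_on (Suc 0) ?S (\<lambda>x. D x v)" by blast
  obtain E where E: "\<And>x. x \<in> ?S \<Longrightarrow> ((\<lambda>x. D x (0, 1)) has_derivative E x) (at x within ?S)"
    and E0: "\<And>v. Ck_on 0 ?S (\<lambda>x. E x v)" using Ck_on_SucD[OF D1[of "(0, 1)"]] by blast
  note cont = Ck_on_imp_continuous_on[OF D1] Ck_on_imp_continuous_on[OF E0]
  show ?thesis
  proof (rule that[of "\<lambda>x. D x (1, 0)" "\<lambda>x. D x (0, 1)" "\<lambda>x. E x (1, 0)"])
    show "\<forall>s\<in>U. \<forall>t\<in>{a..b}. ((\<lambda>t. D (s, t) (1, 0)) has_vector_derivative E (s, t) (1, 0)) (at t within {a..b})"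
      by (intro ballI mixed_partials_exchange[OF U(1) _ _ U(2) s[OF D] t[OF D] s[OF E] cont])
    show "continuous_on ?S (\<lambda>x. D x (1, 0))" "continuous_on ?S (\<lambda>x. D x (0, 1))" by (rule cont)+
    show "continuous_on ?S (\<lambda>x. E x (1, 0))" by (rule cont)
    show "\<forall>s\<in>U. \<forall>t\<in>{a..b}. ((\<lambda>s. \<Gamma> (s, t)) has_vector_derivative D (s, t) (1, 0)) (at s within U)"
      by (intro ballI s[OF D])
    show "\<forall>s\<in>U. \<forall>t\<in>{a..b}. ((\<lambda>t. \<Gamma> (s, t)) has_vector_derivative D (s, t) (0, 1)) (at t within {a..b})"
      by (intro ballI t[OF D])
    show "\<forall>s\<in>U. \<forall>t\<in>{a..b}. ((\<lambda>s. D (s, t) (0, 1)) has_vector_derivative E (s, t) (1, 0)) (at s within U)"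
      by (intro ballI s[OF E])
  qed
qed

section \<open>First variation of the Fisher energy\<close>

text \<open>This is the derivative of \<open>fisher_sqnorm (m, A) (u, B)\<close> when \<open>A, u, B\<close> move with velocities
  \<open>A', u', B'\<close>, simplified by the symmetry of the inverse and the cyclicity of the trace.\<close>

definition fisher_slope where
  "fisher_slope A u B A' u' B' = (let X = matrix_inv A in
     2 * (u' \<bullet> (X *v u)) - (X *v u) \<bullet> (A' *v (X *v u))
     + trace (B' ** X ** B ** X) - trace (A' ** X ** B ** X ** B ** X))"

lemma fisher_sqnorm_has_derivative:
  fixes A :: "real \<Rightarrow> real^'n^'n"
  assumes A: "(A has_vector_derivative A') (at s within U)" and u: "(u has_vector_derivative u') (at s within U)"
    and B: "(B has_vector_derivative B') (at s within U)"
    and s: "s \<in> U" and cA: "continuous_on U A" and pd: "\<And>y. y \<in> U \<Longrightarrow> sym_posdef (A y)"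
  shows "((\<lambda>s. fisher_sqnorm (m s, A s) (u s, B s)) has_vector_derivative
    fisher_slope (A s) (u s) (B s) A' u' B') (at s within U)"
proof -
  let ?X = "\<lambda>s. matrix_inv (A s)" and ?X' = "- (matrix_inv (A s) ** A' ** matrix_inv (A s))"
  interpret mm: bounded_bilinear "(**) :: real^'n^'n \<Rightarrow> real^'n^'n \<Rightarrow> real^'n^'n"
    by (rule bounded_bilinear_matrix_matrix_mult)
  interpret mv: bounded_bilinear "(*v) :: real^'n^'n \<Rightarrow> real^'n \<Rightarrow> real^'n"
    by (rule bounded_bilinear_matrix_vector_mult)
  interpret tr: bounded_linear "trace :: real^'n^'n \<Rightarrow> real"
    by (rule bounded_linear_trace)
  have X: "(?X has_vector_derivative ?X') (at s within U)"
    using pd sym_posdef_invertible by (intro has_vector_derivative_matrix_inv A s cA) blast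
  have sym: "transpose (?X s) = ?X s" using pd s transpose_matrix_inv by blast
  note m1 = mm.has_vector_derivative[OF B X] note m2 = mm.has_vector_derivative[OF m1 B]
  note tr1 = tr.has_vector_derivative[OF mm.has_vector_derivative[OF m2 X]]
  note iv = bounded_bilinear.has_vector_derivative[OF bounded_bilinear_inner u mv.has_vector_derivative[OF X u]]
  have sum: "((\<lambda>s. u s \<bullet> (?X s *v u s) + 1/2 * trace (B s ** ?X s ** B s ** ?X s)) has_vector_derivative
     (u s \<bullet> (?X s *v u' + ?X' *v u s) + u' \<bullet> (?X s *v u s))
     + 1/2 * trace (B s ** ?X s ** B s ** ?X' + (B s ** ?X s ** B' + (B s ** ?X' + B' ** ?X s) ** B s) ** ?X s))
     (at s within U)"
    by (intro has_vector_derivative_add iv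
      bounded_linear.has_vector_derivative[OF bounded_linear_mult_right, OF tr1])
  have t1: "trace (B s ** ?X s ** B s ** ?X s ** A' ** ?X s) = trace (A' ** ?X s ** B s ** ?X s ** B s ** ?X s)"
    using trace_mul_sym[of "B s ** ?X s ** B s ** ?X s" "A' ** ?X s"] by (simp add: matrix_mul_assoc)
  have t2: "trace (B s ** ?X s ** B' ** ?X s) = trace (B' ** ?X s ** B s ** ?X s)"
    using trace_mul_sym[of "B s ** ?X s" "B' ** ?X s"] by (simp add: matrix_mul_assoc)
  have t3: "trace (B s ** ?X s ** A' ** ?X s ** B s ** ?X s) = trace (A' ** ?X s ** B s ** ?X s ** B s ** ?X s)"
    using trace_mul_sym[of "B s ** ?X s" "A' ** ?X s ** B s ** ?X s"] by (simp add: matrix_mul_assoc)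
  have i1: "u s \<bullet> (?X s *v u') = u' \<bullet> (?X s *v u s)"
    using inner_symmetric_mult[OF sym, of "u s" u'] by (simp only: inner_commute)
  have i2: "u s \<bullet> ((?X s ** A' ** ?X s) *v u s) = (?X s *v u s) \<bullet> (A' *v (?X s *v u s))"
    by (simp add: inner_symmetric_mult[OF sym, of "u s"] flip: matrix_vector_mul_assoc)
  show ?thesis
    unfolding fisher_sqnorm_def prod.case fisher_slope_def Let_def
    by (rule has_vector_derivative_eq_rhs[OF sum])
      (simp add: mm.add_left mm.add_right mm.minus_left mm.minus_right mv.minus_left tr.add tr.neg
        tr.diff mm.diff_left mm.diff_right matrix_mul_assoc inner_add_right inner_diff_right t1 t2 t3 i1 i2 field_simps)
qed

lemma continuous_on_fisher_sqnorm:
  fixes A :: "'a::topological_space \<Rightarrow> real^'n^'n"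
  assumes A: "continuous_on S A" "continuous_on S u" "continuous_on S B"
    and pd: "\<And>y. y \<in> S \<Longrightarrow> sym_posdef (A y)"
  shows "continuous_on S (\<lambda>s. fisher_sqnorm (m s, A s) (u s, B s))"
proof -
  have X: "continuous_on S (\<lambda>s. matrix_inv (A s))"
    using A pd sym_posdef_invertible by (intro continuous_on_matrix_inv) auto
  show ?thesis unfolding fisher_sqnorm_def prod.case
    by (intro continuous_intros A X bounded_bilinear.continuous_on[OF bounded_bilinear_matrix_matrix_mult]
      bounded_bilinear.continuous_on[OF bounded_bilinear_matrix_vector_mult] bounded_linear.continuous_on[OF bounded_linear_trace])
qed

lemma continuous_on_fisher_slope:
  fixes A :: "'a::topological_space \<Rightarrow> real^'n^'n"
  assumes A: "continuous_on S A" "continuous_on S u" "continuous_on S B"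
     "continuous_on S A'" "continuous_on S u'" "continuous_on S B'"
    and pd: "\<And>y. y \<in> S \<Longrightarrow> sym_posdef (A y)"
  shows "continuous_on S (\<lambda>s. fisher_slope (A s) (u s) (B s) (A' s) (u' s) (B' s))"
proof -
  have X: "continuous_on S (\<lambda>s. matrix_inv (A s))"
    using A pd sym_posdef_invertible by (intro continuous_on_matrix_inv) auto
  show ?thesis unfolding fisher_slope_def Let_def
    by (intro continuous_intros A X bounded_bilinear.continuous_on[OF bounded_bilinear_matrix_matrix_mult]
      bounded_bilinear.continuous_on[OF bounded_bilinear_matrix_vector_mult] bounded_linear.continuous_on[OF bounded_linear_trace])
qed

text \<open>The Leibniz rule gives the derivative of the energy as the integral of \<open>fisher_slope\<close>, in which the
  derivative in \<open>t\<close> of the variation field \<open>\<delta>\<close> occurs. It is removed by an integration by parts: the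
  slope plus the stated Euler--Lagrange integrand is the derivative of
  \<open>2 (fst \<delta> \<bullet> P) + tr (snd \<delta> Q)\<close>, which vanishes at both ends because the variation is proper.\<close>

lemma first_variation:
  fixes \<mu> :: "real \<Rightarrow> real^'d" and \<Sigma> :: "real \<Rightarrow> real^'d^'d"
  assumes ab: "a < b" and \<epsilon>: "\<epsilon> > 0"
    and var: "proper_variation gaussian_manifold a b (\<lambda>t. (\<mu> t, \<Sigma> t)) \<epsilon> \<Gamma>"
    and \<mu>: "\<And>t. t \<in> {a..b} \<Longrightarrow> (\<mu> has_vector_derivative \<mu>' t) (at t within {a..b})"
    and \<Sigma>: "\<And>t. t \<in> {a..b} \<Longrightarrow> (\<Sigma> has_vector_derivative \<Sigma>' t) (at t within {a..b})"
    and P_def: "\<And>t. P t = matrix_inv (\<Sigma> t) *v \<mu>' t"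
    and P: "\<And>t. t \<in> {a..b} \<Longrightarrow> (P has_vector_derivative P' t) (at t within {a..b})"
    and Q_def: "\<And>t. Q t = matrix_inv (\<Sigma> t) ** \<Sigma>' t ** matrix_inv (\<Sigma> t)"
    and Q: "\<And>t. t \<in> {a..b} \<Longrightarrow> (Q has_vector_derivative Q' t) (at t within {a..b})"
    and \<delta>: "\<And>t. \<delta> t = vector_derivative (\<lambda>s. \<Gamma> (s, t)) (at 0)"
  shows "((\<lambda>s. energy fisher_sqnorm a b (\<lambda>t. \<Gamma> (s, t))) has_real_derivative
    - integral {a..b} (\<lambda>t. 2 * (fst (\<delta> t) \<bullet> P' t) +
        trace (snd (\<delta> t) ** (Q' t + Q t ** \<Sigma> t ** Q t + outer_prod (P t) (P t))))) (at 0)"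
proof -
  interpret mm: bounded_bilinear "(**) :: real^'d^'d \<Rightarrow> real^'d^'d \<Rightarrow> real^'d^'d"
    by (rule bounded_bilinear_matrix_matrix_mult)
  interpret tr: bounded_linear "trace :: real^'d^'d \<Rightarrow> real"
    by (rule bounded_linear_trace)
  define U where "U = {-\<epsilon><..<\<epsilon>}"
  have U: "convex U" "open U" "0 \<in> U" unfolding U_def using \<epsilon> by auto
  have atU: "at s within U = at s" if "s \<in> U" for s using that U(2) by (rule at_within_open)
  have nbU: "at s within U \<noteq> bot" if "s \<in> U" for s using atU[OF that] by simp
  have C2: "Ck_on 2 (U \<times> {a..b}) \<Gamma>"
    and G0: "\<And>t. t \<in> {a..b} \<Longrightarrow> \<Gamma> (0, t) = (\<mu> t, \<Sigma> t)"
    and Gend: "\<And>s. s \<in> U \<Longrightarrow> \<Gamma> (s, a) = (\<mu> a, \<Sigma> a)" "\<And>s. s \<in> U \<Longrightarrow> \<Gamma> (s, b) = (\<mu> b, \<Sigma> b)"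
    using var unfolding proper_variation_def U_def by (auto simp: smooth_on_def)
  have pd: "sym_posdef (snd (\<Gamma> x))" if "x \<in> U \<times> {a..b}" for x
    using var that unfolding proper_variation_def U_def gaussian_manifold_def by fastforce
  obtain \<Gamma>s \<Gamma>t \<Gamma>ts where cont:
    "continuous_on (U \<times> {a..b}) \<Gamma>s" "continuous_on (U \<times> {a..b}) \<Gamma>t" "continuous_on (U \<times> {a..b}) \<Gamma>ts"
    and ds': "\<forall>s\<in>U. \<forall>t\<in>{a..b}. ((\<lambda>s. \<Gamma> (s, t)) has_vector_derivative \<Gamma>s (s, t)) (at s within U)"
    and dt': "\<forall>s\<in>U. \<forall>t\<in>{a..b}. ((\<lambda>t. \<Gamma> (s, t)) has_vector_derivative \<Gamma>t (s, t)) (at t within {a..b})"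
    and dts': "\<forall>s\<in>U. \<forall>t\<in>{a..b}. ((\<lambda>s. \<Gamma>t (s, t)) has_vector_derivative \<Gamma>ts (s, t)) (at s within U)"
    and dst': "\<forall>s\<in>U. \<forall>t\<in>{a..b}. ((\<lambda>t. \<Gamma>s (s, t)) has_vector_derivative \<Gamma>ts (s, t)) (at t within {a..b})"
    by (rule C2_on_rectangle[OF C2 U(1) nbU])
  note ds = ds'[rule_format] and dt = dt'[rule_format] and dts = dts'[rule_format] and dst = dst'[rule_format]
  have cG: "continuous_on (U \<times> {a..b}) \<Gamma>" using C2 by (rule Ck_on_imp_continuous_on)
  note cont = cont cG
  define E where "E s t = fisher_sqnorm (fst (\<Gamma> (s, t)), snd (\<Gamma> (s, t))) (fst (\<Gamma>t (s, t)), snd (\<Gamma>t (s, t)))" for s t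
  define D where "D s t = fisher_slope (snd (\<Gamma> (s, t))) (fst (\<Gamma>t (s, t))) (snd (\<Gamma>t (s, t)))
    (snd (\<Gamma>s (s, t))) (fst (\<Gamma>ts (s, t))) (snd (\<Gamma>ts (s, t)))" for s t
  have sec: "continuous_on {a..b} (\<lambda>t. f (s, t))" if "continuous_on (U \<times> {a..b}) f" "s \<in> U"
    for f :: "real \<times> real \<Rightarrow> 'z::topological_space" and s
    by (rule continuous_on_compose2[OF that(1)]) (use that in \<open>auto intro!: continuous_intros\<close>)
  have sec': "continuous_on U (\<lambda>s. f (s, t))" if "continuous_on (U \<times> {a..b}) f" "t \<in> {a..b}"
    for f :: "real \<times> real \<Rightarrow> 'z::topological_space" and t
    by (rule continuous_on_compose2[OF that(1)]) (use that in \<open>auto intro!: continuous_intros\<close>)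
  have cD: "continuous_on (U \<times> {a..b}) (\<lambda>(s, t). D s t)"
    unfolding D_def split_beta prod.collapse
    by (intro continuous_on_fisher_slope continuous_on_fst continuous_on_snd cont pd)
  have cE: "continuous_on {a..b} (E s)" if "s \<in> U" for s
  proof -
    have "continuous_on (U \<times> {a..b}) (\<lambda>x. fisher_sqnorm (fst (\<Gamma> x), snd (\<Gamma> x)) (fst (\<Gamma>t x), snd (\<Gamma>t x)))"
      by (intro continuous_on_fisher_sqnorm continuous_on_fst continuous_on_snd cont pd)
    from sec[OF this that] show ?thesis unfolding E_def .
  qed
  have energy: "energy fisher_sqnorm a b (\<lambda>t. \<Gamma> (s, t)) = integral (cbox a b) (E s)" if "s \<in> U" for s
  proof -
    have "vector_derivative (\<lambda>t. \<Gamma> (s, t)) (at t within {a..b}) = \<Gamma>t (s, t)" if "t \<in> {a..b}" for t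
      using vector_derivative_within_cbox[of a b t "\<lambda>t. \<Gamma> (s, t)"] ab that dt[OF \<open>s \<in> U\<close> that] by simp
    then show ?thesis unfolding energy_def E_def by (auto intro!: integral_cong)
  qed
  have "((\<lambda>s. E s t) has_vector_derivative D s t) (at s within U)" if "s \<in> U" "t \<in> {a..b}" for s t
    unfolding E_def D_def
    using that pd by (intro fisher_sqnorm_has_derivative sec' continuous_on_snd cont
       bounded_linear.has_vector_derivative[OF bounded_linear_fst]
       bounded_linear.has_vector_derivative[OF bounded_linear_snd] ds dts) auto
  then have "((\<lambda>s. integral (cbox a b) (E s)) has_vector_derivative integral (cbox a b) (D 0)) (at 0 within U)"
    using cD cE U by (intro leibniz_rule_vector_derivative) (auto intro: integrable_continuous_real)
  then have main: "((\<lambda>s. energy fisher_sqnorm a b (\<lambda>t. \<Gamma> (s, t))) has_vector_derivative integral {a..b} (D 0)) (at 0)"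
    using has_vector_derivative_transform[OF U(3) energy] atU[OF U(3)] by simp

  \<comment> \<open>Integration by parts: \<open>D 0 + EL\<close> has the primitive \<open>F\<close>.\<close>
  define EL where "EL t = 2 * (fst (\<delta> t) \<bullet> P' t) +
        trace (snd (\<delta> t) ** (Q' t + Q t ** \<Sigma> t ** Q t + outer_prod (P t) (P t)))" for t
  define F where "F t = 2 * (fst (\<Gamma>s (0, t)) \<bullet> P t) + trace (snd (\<Gamma>s (0, t)) ** Q t)" for t
  have s0: "\<Gamma>s (0, t) = \<delta> t" if "t \<in> {a..b}" for t
    using ds[OF U(3) that] atU[OF U(3)] \<delta> by (simp add: vector_derivative_at)
  have Gt0: "\<Gamma>t (0, t) = (\<mu>' t, \<Sigma>' t)" if t: "t \<in> {a..b}" for t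
  proof -
    have "((\<lambda>t. \<Gamma> (0, t)) has_vector_derivative (\<mu>' t, \<Sigma>' t)) (at t within {a..b})"
      using has_vector_derivative_transform[OF t G0 has_vector_derivative_Pair[OF \<mu>[OF t] \<Sigma>[OF t]]] .
    then show ?thesis
      using vector_derivative_unique_within_closed_interval[of a b t] ab t dt[OF U(3) t] by simp
  qed
  have F0: "F t = 0" if "t = a \<or> t = b" for t
  proof -
    have t: "t \<in> {a..b}" using that ab by auto
    have "((\<lambda>s. \<Gamma> (s, t)) has_vector_derivative 0) (at 0 within U)"
      by (rule has_vector_derivative_transform[OF U(3) _ has_vector_derivative_const[of "(\<mu> t, \<Sigma> t)"]])
         (use that Gend in auto)
    then have "\<Gamma>s (0, t) = 0"
      using vector_derivative_unique_within[OF nbU[OF U(3)] ds[OF U(3) t]] by simp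
    then show ?thesis by (simp add: F_def tr.zero mm.zero_left)
  qed
  have "(F has_vector_derivative D 0 t + EL t) (at t within {a..b})" if t: "t \<in> {a..b}" for t
  proof -
    let ?X = "matrix_inv (\<Sigma> t)"
    have pdt: "sym_posdef (\<Sigma> t)" using pd[of "(0, t)"] t U G0 by simp
    have sym: "transpose ?X = ?X" using pdt by (rule transpose_matrix_inv)
    obtain m A where mA: "\<Gamma>s (0, t) = (m, A)" by fastforce
    obtain m' A' where mA': "\<Gamma>ts (0, t) = (m', A')" by fastforce
    have d: "((\<lambda>t. fst (\<Gamma>s (0, t))) has_vector_derivative m') (at t within {a..b})"
      "((\<lambda>t. snd (\<Gamma>s (0, t))) has_vector_derivative A') (at t within {a..b})"
      using bounded_linear.has_vector_derivative[OF bounded_linear_fst dst[OF U(3) t]]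
        bounded_linear.has_vector_derivative[OF bounded_linear_snd dst[OF U(3) t]] mA' by simp_all
    have F: "(F has_vector_derivative 2 * (m \<bullet> P' t + m' \<bullet> P t) + trace (A ** Q' t + A' ** Q t)) (at t within {a..b})"
      using has_vector_derivative_add[OF
          bounded_linear.has_vector_derivative[OF bounded_linear_mult_right[of 2],
            OF bounded_bilinear.has_vector_derivative[OF bounded_bilinear_inner d(1) P[OF t]]]
          tr.has_vector_derivative[OF mm.has_vector_derivative[OF d(2) Q[OF t]]]]
      by (simp add: F_def[abs_def] mA)
    have D: "D 0 t = 2 * (m' \<bullet> P t) - P t \<bullet> (A *v P t) + trace (A' ** Q t) - trace (A ** (Q t ** \<Sigma> t ** Q t))"
    proof -
      have "Q t ** \<Sigma> t ** Q t = ?X ** \<Sigma>' t ** (?X ** \<Sigma> t) ** ?X ** \<Sigma>' t ** ?X"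
        by (simp add: Q_def matrix_mul_assoc)
      then have "Q t ** \<Sigma> t ** Q t = ?X ** \<Sigma>' t ** ?X ** \<Sigma>' t ** ?X"
        by (simp add: matrix_inv_works sym_posdef_invertible pdt)
      then show ?thesis
        by (simp add: D_def fisher_slope_def Let_def Gt0[OF t] G0[OF t] mA mA' P_def Q_def matrix_mul_assoc)
    qed
    have "EL t = 2 * (m \<bullet> P' t) + trace (A ** Q' t) + trace (A ** (Q t ** \<Sigma> t ** Q t)) + P t \<bullet> (A *v P t)"
      by (simp add: EL_def flip: s0[OF t]) (simp add: mA mm.add_right tr.add trace_mult_outer_prod)
    with D have "2 * (m \<bullet> P' t + m' \<bullet> P t) + trace (A ** Q' t + A' ** Q t) = D 0 t + EL t"
      by (simp add: tr.add algebra_simps)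
    with F show ?thesis by simp
  qed
  then have "((\<lambda>t. D 0 t + EL t) has_integral F b - F a) {a..b}"
    using ab by (intro fundamental_theorem_of_calculus) auto
  moreover have "(D 0 has_integral integral {a..b} (D 0)) {a..b}"
    using sec[OF cD U(3)] by (intro integrable_integral integrable_continuous_real) simp
  ultimately have "((\<lambda>t. (D 0 t + EL t) - D 0 t) has_integral (F b - F a) - integral {a..b} (D 0)) {a..b}"
    by (rule has_integral_diff)
  then have "integral {a..b} EL = - integral {a..b} (D 0)"
    using F0 by (simp add: integral_unique)
  then show ?thesis
    using main unfolding has_real_derivative_iff_has_vector_derivative EL_def[abs_def] by simp
qed

section \<open>Test variations\<close>

text \<open>The constant is the minimum of the quadratic forms over the product of \<open>K\<close> and the unit sphere, which
  is compact.\<close>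

lemma sym_posdef_uniform:
  fixes \<Sigma> :: "'a::topological_space \<Rightarrow> real^'d^'d"
  assumes K: "compact K" and c: "continuous_on K \<Sigma>" and pd: "\<And>t. t \<in> K \<Longrightarrow> sym_posdef (\<Sigma> t)"
  obtains c where "c > 0" "\<And>t x. t \<in> K \<Longrightarrow> c * (norm x)\<^sup>2 \<le> x \<bullet> (\<Sigma> t *v x)"
proof (cases "K = {}")
  case True then show ?thesis using that[of 1] by simp
next
  case False
  let ?S = "K \<times> sphere (0 :: real^'d) 1"
  have "continuous_on ?S (\<lambda>y. \<Sigma> (fst y))"
    by (rule continuous_on_compose2[OF c]) (auto intro: continuous_intros)
  then have "continuous_on ?S (\<lambda>y. snd y \<bullet> (\<Sigma> (fst y) *v snd y))"
    by (intro continuous_intros bounded_bilinear.continuous_on[OF bounded_bilinear_matrix_vector_mult])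
  moreover have "compact ?S" "?S \<noteq> {}" using K False by (auto intro: compact_Times)
  ultimately obtain z where z: "z \<in> ?S"
    and min: "\<And>y. y \<in> ?S \<Longrightarrow> snd z \<bullet> (\<Sigma> (fst z) *v snd z) \<le> snd y \<bullet> (\<Sigma> (fst y) *v snd y)"
    using continuous_attains_inf[of ?S "\<lambda>y. snd y \<bullet> (\<Sigma> (fst y) *v snd y)"] by blast
  define c where "c = snd z \<bullet> (\<Sigma> (fst z) *v snd z)"
  have "snd z \<noteq> 0" using z by auto
  then have "c > 0" using z pd by (auto simp: c_def sym_posdef_def)
  moreover have "c * (norm x)\<^sup>2 \<le> x \<bullet> (\<Sigma> t *v x)" if "t \<in> K" for t x
  proof (cases "x = 0")
    case False
    let ?y = "x /\<^sub>R norm x"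
    have "c \<le> ?y \<bullet> (\<Sigma> t *v ?y)" using min[of "(t, ?y)"] that False by (simp add: c_def)
    also have "\<dots> = (x \<bullet> (\<Sigma> t *v x)) / (norm x)\<^sup>2"
      by (simp add: matrix_vector_mult_scaleR power2_eq_square divide_inverse)
    finally show ?thesis using False by (simp add: field_simps)
  qed simp
  ultimately show ?thesis by (rule that)
qed

text \<open>The variation adds to the curve the field \<open>(e, B)\<close> with the weight \<open>s (t - a) (b - t)\<close>, which vanishes at
  both ends. The covariance stays positive definite for small \<open>s\<close> by the uniform bound
  of the preceding lemma.\<close>

lemma linear_variation_proper:
  fixes \<mu> :: "real \<Rightarrow> real^'d" and \<Sigma> :: "real \<Rightarrow> real^'d^'d"
  assumes ab: "a < b" and sm: "smooth_on {a..b} (\<lambda>t. (\<mu> t, \<Sigma> t))"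
    and pd: "\<And>t. t \<in> {a..b} \<Longrightarrow> sym_posdef (\<Sigma> t)" and B: "transpose B = B"
  obtains \<epsilon> where "\<epsilon> > 0"
    "proper_variation gaussian_manifold a b (\<lambda>t. (\<mu> t, \<Sigma> t)) \<epsilon>
      (\<lambda>x. (\<mu> (snd x), \<Sigma> (snd x)) + (fst x * ((snd x - a) * (b - snd x))) *\<^sub>R (e, B))"
proof -
  let ?\<Gamma> = "\<lambda>x. (\<mu> (snd x), \<Sigma> (snd x)) + (fst x * ((snd x - a) * (b - snd x))) *\<^sub>R (e, B)"
  have "continuous_on {a..b} (\<lambda>t. (\<mu> t, \<Sigma> t))"
    using Ck_on_imp_continuous_on[OF smooth_on_imp_Ck_on[OF sm]] .
  then have "continuous_on {a..b} \<Sigma>" using continuous_on_snd by fastforce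
  then obtain c where c: "c > 0" "\<And>t x. t \<in> {a..b} \<Longrightarrow> c * (norm x)\<^sup>2 \<le> x \<bullet> (\<Sigma> t *v x)"
    using sym_posdef_uniform[of "{a..b}" \<Sigma>] pd by blast
  define M where "M = onorm ((*v) B) + 1"
  have M: "M > 0" using onorm_pos_le[of "(*v) B"] by (simp add: M_def)
  have Bx: "\<bar>x \<bullet> (B *v x)\<bar> \<le> M * (norm x)\<^sup>2" for x
  proof -
    have "\<bar>x \<bullet> (B *v x)\<bar> \<le> norm x * norm (B *v x)" by (rule Cauchy_Schwarz_ineq2)
    also have "\<dots> \<le> norm x * (onorm ((*v) B) * norm x)"
      by (intro mult_left_mono onorm) auto
    also have "\<dots> \<le> M * (norm x)\<^sup>2" by (simp add: M_def power2_eq_square algebra_simps)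
    finally show ?thesis .
  qed
  \<comment> \<open>The weight is at most \<open>\<bar>s\<bar> (b - a)\<^sup>2\<close>, so its product with \<open>M\<close> stays below \<open>c\<close>.\<close>
  define \<epsilon> where "\<epsilon> = c / (M * (b - a)\<^sup>2)"
  have \<epsilon>: "\<epsilon> > 0" using c M ab by (simp add: \<epsilon>_def)
  have pos: "sym_posdef (\<Sigma> t + (s * ((t - a) * (b - t))) *\<^sub>R B)" if s: "\<bar>s\<bar> < \<epsilon>" and t: "t \<in> {a..b}" for s t
    unfolding sym_posdef_def
  proof (intro conjI allI impI)
    have "transpose (\<Sigma> t) = \<Sigma> t" using pd[OF t] by (simp add: sym_posdef_def)
    then show "transpose (\<Sigma> t + (s * ((t - a) * (b - t))) *\<^sub>R B) = \<Sigma> t + (s * ((t - a) * (b - t))) *\<^sub>R B"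
      using B by (simp add: transpose_def vec_eq_iff)
    fix x :: "real^'d" assume x: "x \<noteq> 0"
    let ?r = "s * ((t - a) * (b - t))"
    have "\<bar>?r\<bar> \<le> \<bar>s\<bar> * (b - a)\<^sup>2"
      using t by (simp add: abs_mult power2_eq_square mult_mono mult_left_mono)
    then have "\<bar>?r\<bar> * M \<le> \<bar>s\<bar> * (b - a)\<^sup>2 * M" using M by (intro mult_right_mono) auto
    also have "\<dots> < c" using s M ab by (simp add: \<epsilon>_def field_simps)
    finally have "\<bar>?r\<bar> * M * (norm x)\<^sup>2 < c * (norm x)\<^sup>2" using x by simp
    moreover have "\<bar>?r * (x \<bullet> (B *v x))\<bar> \<le> \<bar>?r\<bar> * (M * (norm x)\<^sup>2)"
      unfolding abs_mult[of ?r] by (intro mult_left_mono Bx) auto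
    ultimately have "0 < x \<bullet> (\<Sigma> t *v x) + ?r * (x \<bullet> (B *v x))"
      using c(2)[OF t, of x] by (simp add: mult.assoc)
    then show "0 < x \<bullet> ((\<Sigma> t + ?r *\<^sub>R B) *v x)"
      by (simp add: matrix_vector_mult_add_rdistrib inner_add_right flip: scaleR_matrix_vector_assoc)
  qed
  have "Ck_on k ({-\<epsilon><..<\<epsilon>} \<times> {a..b}) ?\<Gamma>" for k
  proof -
    let ?S = "{-\<epsilon><..<\<epsilon>} \<times> {a..b}"
    have "Ck_on k ?S (\<lambda>x. (\<mu> (snd x), \<Sigma> (snd x)))"
      by (rule Ck_on_compose_linear[OF bounded_linear_snd smooth_on_imp_Ck_on[OF sm]]) auto
    moreover have "Ck_on k ?S (\<lambda>x. snd x + (- a))" "Ck_on k ?S (\<lambda>x. b + (- snd x))"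
      by (intro Ck_on_add Ck_on_const Ck_on_linear bounded_linear_minus bounded_linear_snd)+
    moreover have "Ck_on k ?S fst" by (rule Ck_on_linear[OF bounded_linear_fst])
    ultimately have "Ck_on k ?S (\<lambda>x. (\<mu> (snd x), \<Sigma> (snd x)))" "Ck_on k ?S (\<lambda>x. fst x * ((snd x - a) * (b - snd x)))"
      using Ck_on_bilinear[OF bounded_bilinear_mult, of k ?S fst "\<lambda>x. (snd x - a) * (b - snd x)"]
        Ck_on_bilinear[OF bounded_bilinear_mult, of k ?S "\<lambda>x. snd x - a" "\<lambda>x. b - snd x"] by simp_all
    then show ?thesis
      by (intro Ck_on_add Ck_on_bilinear[OF bounded_bilinear_scaleR] Ck_on_const)
  qed
  then have "proper_variation gaussian_manifold a b (\<lambda>t. (\<mu> t, \<Sigma> t)) \<epsilon> ?\<Gamma>"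
    unfolding proper_variation_def smooth_on_def
    by (auto simp: gaussian_manifold_def intro!: pos)
  with \<epsilon> show ?thesis by (rule that)
qed

text \<open>The fundamental lemma of the calculus of variations without bump functions. The endpoints are free,
  so around a point where \<open>f\<close>, up to sign, is positive \<open>[a, b]\<close> can be chosen inside a region where \<open>f\<close> is
  positive, and there the integrand is nonnegative and not identically zero.\<close>

lemma fundamental_lemma_quadratic_weights:
  fixes f :: "real \<Rightarrow> real"
  assumes I: "is_interval I" "\<And>x. I \<noteq> {x}" and f: "continuous_on I f"
    and int: "\<And>a b. a < b \<Longrightarrow> {a..b} \<subseteq> I \<Longrightarrow> integral {a..b} (\<lambda>t. (t - a) * (b - t) * f t) = 0"
    and t: "t \<in> I"
  shows "f t = 0"
proof -
  have False if g: "continuous_on I g" and pos: "g t > 0"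
    and int: "\<And>a b. a < b \<Longrightarrow> {a..b} \<subseteq> I \<Longrightarrow> integral {a..b} (\<lambda>t. (t - a) * (b - t) * g t) = 0"
    for g :: "real \<Rightarrow> real"
  proof -
    obtain d where d0: "d > 0" and "\<forall>u\<in>I. dist u t < d \<longrightarrow> dist (g u) (g t) < g t"
      using g t pos unfolding continuous_on_iff by blast
    then have d: "g u > 0" if "u \<in> I" "dist u t < d" for u
      using that unfolding dist_real_def by force
    have "t islimpt I" using connected_imp_perfect[of I t] I t is_interval_connected by blast
    then obtain u where u: "u \<in> I" "u \<noteq> t" "dist u t < d"
      using d0 unfolding islimpt_approachable by blast
    define a b where "a = min u t" and "b = max u t"
    have ab: "a < b" "{a..b} \<subseteq> I" and near: "\<And>v. v \<in> {a..b} \<Longrightarrow> dist v t < d"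
    proof -
      show "a < b" using u(2) by (auto simp: a_def b_def)
      have "a \<in> I" "b \<in> I" using u t by (auto simp: a_def b_def min_def max_def)
      then show "{a..b} \<subseteq> I" using mem_is_interval_1_I[OF I(1), of a b] by (meson atLeastAtMost_iff subsetI)
      show "\<And>v. v \<in> {a..b} \<Longrightarrow> dist v t < d" using u(3) unfolding a_def b_def dist_real_def atLeastAtMost_iff by linarith
    qed
    let ?h = "\<lambda>t. (t - a) * (b - t) * g t"
    have "continuous_on {a..b} ?h" using continuous_on_subset[OF g ab(2)] by (intro continuous_intros)
    moreover have "?h v \<ge> 0" if "v \<in> {a..b}" for v
      using that d[of v] near[OF that] ab(2) by (intro mult_nonneg_nonneg) auto
    ultimately have "\<forall>v\<in>{a..b}. ?h v = 0" using integral_eq_0_iff[of a b ?h] int[OF ab] ab(1) by blast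
    moreover have m: "(a + b) / 2 \<in> {a..b}" using ab(1) by auto
    ultimately have "?h ((a + b) / 2) = 0" by blast
    moreover have "g ((a + b) / 2) > 0" using m near ab(2) d by blast
    ultimately show False using ab(1) by auto
  qed
  from this[of f] this[of "\<lambda>t. - f t"] f int show ?thesis
    by (cases "f t" "0 :: real" rule: linorder_cases) (auto intro: continuous_intros)
qed

section \<open>Euler--Lagrange equations and their first integrals\<close>

text \<open>A $C^2$ curve of Gaussian distributions; \<open>\<mu>1, \<mu>2, \<Sigma>1, \<Sigma>2\<close> are the first and second derivatives of its
  coordinates.\<close>

locale gaussian_curve =
  fixes I :: "real set" and \<mu> \<mu>1 \<mu>2 :: "real \<Rightarrow> real^'d" and \<Sigma> \<Sigma>1 \<Sigma>2 :: "real \<Rightarrow> real^'d^'d"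
  assumes interval: "is_interval I" and nondegenerate: "\<And>x. I \<noteq> {x}"
    and pd: "\<And>t. t \<in> I \<Longrightarrow> sym_posdef (\<Sigma> t)"
    and \<mu>1: "\<And>t. t \<in> I \<Longrightarrow> (\<mu> has_vector_derivative \<mu>1 t) (at t within I)"
    and \<mu>2: "\<And>t. t \<in> I \<Longrightarrow> (\<mu>1 has_vector_derivative \<mu>2 t) (at t within I)"
    and \<Sigma>1: "\<And>t. t \<in> I \<Longrightarrow> (\<Sigma> has_vector_derivative \<Sigma>1 t) (at t within I)"
    and \<Sigma>2: "\<And>t. t \<in> I \<Longrightarrow> (\<Sigma>1 has_vector_derivative \<Sigma>2 t) (at t within I)"
    and cont_\<mu>2: "continuous_on I \<mu>2" and cont_\<Sigma>2: "continuous_on I \<Sigma>2"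
begin

interpretation mm: bounded_bilinear "(**) :: real^'d^'d \<Rightarrow> real^'d^'d \<Rightarrow> real^'d^'d"
  by (rule bounded_bilinear_matrix_matrix_mult)
interpretation mv: bounded_bilinear "(*v) :: real^'d^'d \<Rightarrow> real^'d \<Rightarrow> real^'d"
  by (rule bounded_bilinear_matrix_vector_mult)
interpretation op: bounded_bilinear "outer_prod :: real^'d \<Rightarrow> real^'d \<Rightarrow> real^'d^'d"
  by (rule bounded_bilinear_outer_prod)

interpretation tr: bounded_linear "trace :: real^'d^'d \<Rightarrow> real"
  by (rule bounded_linear_trace)

text \<open>A name with \<open>1\<close> appended stands for the derivative of the function without it: for \<open>X1\<close>, \<open>P1\<close> and \<open>Q1\<close> the
  values are those of the product rule. The momenta \<open>P\<close> and \<open>Q\<close> are conjugate to the mean and the covariance,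
  and \<open>(2 P1, W)\<close> is, up to sign, the Euler--Lagrange expression of the energy.\<close>

definition X where "X t = matrix_inv (\<Sigma> t)"
definition X1 where "X1 t = - (X t ** \<Sigma>1 t ** X t)"
definition P where "P t = X t *v \<mu>1 t"
definition P1 where "P1 t = X t *v \<mu>2 t + X1 t *v \<mu>1 t"
definition Q where "Q t = X t ** \<Sigma>1 t ** X t"
definition Q1 where "Q1 t = X t ** \<Sigma>1 t ** X1 t + (X t ** \<Sigma>2 t + X1 t ** \<Sigma>1 t) ** X t"
definition W where "W t = Q1 t + Q t ** \<Sigma> t ** Q t + outer_prod (P t) (P t)"

lemma nontrivial: "t \<in> I \<Longrightarrow> at t within I \<noteq> bot"
  using connected_imp_perfect[OF is_interval_connected[OF interval] _ nondegenerate]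
  unfolding trivial_limit_within by blast

lemma cont: "continuous_on I \<mu>" "continuous_on I \<mu>1" "continuous_on I \<Sigma>" "continuous_on I \<Sigma>1"
  using \<mu>1 \<mu>2 \<Sigma>1 \<Sigma>2 by (blast intro: has_vector_derivative_continuous continuous_on_eq_continuous_within[THEN iffD2])+

lemma X_\<Sigma>: "t \<in> I \<Longrightarrow> X t ** \<Sigma> t = mat 1" "t \<in> I \<Longrightarrow> \<Sigma> t ** X t = mat 1"
  by (simp_all add: X_def matrix_inv_works sym_posdef_invertible pd)

lemma X_deriv: "t \<in> I \<Longrightarrow> (X has_vector_derivative X1 t) (at t within I)"
  unfolding X_def[abs_def] X1_def
  using has_vector_derivative_matrix_inv[OF \<Sigma>1 _ sym_posdef_invertible[OF pd] cont(3)] by simp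

lemma cont_X: "continuous_on I X"
  unfolding X_def[abs_def] by (intro continuous_on_matrix_inv cont sym_posdef_invertible pd)

lemma P_deriv: "t \<in> I \<Longrightarrow> (P has_vector_derivative P1 t) (at t within I)"
  unfolding P_def[abs_def] P1_def by (intro mv.has_vector_derivative X_deriv \<mu>2)

lemma Q_deriv: "t \<in> I \<Longrightarrow> (Q has_vector_derivative Q1 t) (at t within I)"
  unfolding Q_def[abs_def] Q1_def by (intro mm.has_vector_derivative X_deriv \<Sigma>2)

lemma cont_P1: "continuous_on I P1"
  unfolding P1_def[abs_def] X1_def
  by (intro continuous_intros mm.continuous_on mv.continuous_on cont cont_X cont_\<mu>2)

lemma cont_W: "continuous_on I W"
  unfolding W_def[abs_def] Q1_def X1_def Q_def P_def
  by (intro continuous_intros mm.continuous_on mv.continuous_on op.continuous_on cont cont_X cont_\<Sigma>2)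

lemma transpose_X: "t \<in> I \<Longrightarrow> transpose (X t) = X t"
  unfolding X_def by (intro transpose_matrix_inv pd)

lemma transpose_deriv:
  fixes A :: "real \<Rightarrow> real^'d^'d"
  assumes A: "(A has_vector_derivative A') (at t within I)" and t: "t \<in> I"
    and sym: "\<And>t. t \<in> I \<Longrightarrow> transpose (A t) = A t"
  shows "transpose A' = A'"
proof -
  have "((\<lambda>t. transpose (A t)) has_vector_derivative transpose A') (at t within I)"
    by (rule bounded_linear.has_vector_derivative[OF bounded_linear_transpose A])
  then have "(A has_vector_derivative transpose A') (at t within I)"
    by (rule has_vector_derivative_transform[OF t, rotated]) (simp add: sym)
  then show ?thesis by (rule vector_derivative_unique_within[OF nontrivial[OF t] _ A])
qed

text \<open>Symmetry makes \<open>W t\<close> itself an admissible direction for the covariance. This choice of test direction is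
  what forces \<open>W t = 0\<close>, as \<open>tr (W W) = tr (W W\<^sup>T)\<close> is the squared Euclidean norm of \<open>W\<close>.\<close>

lemma transpose_W: assumes t: "t \<in> I" shows "transpose (W t) = W t"
proof -
  have sym\<Sigma>: "transpose (\<Sigma> t) = \<Sigma> t" if "t \<in> I" for t using pd[OF that] by (simp add: sym_posdef_def)
  have "transpose (Q t) = Q t" if "t \<in> I" for t
    using transpose_X[OF that] transpose_deriv[OF \<Sigma>1[OF that] that sym\<Sigma>]
    by (simp add: Q_def matrix_transpose_mul matrix_mul_assoc)
  with transpose_deriv[OF Q_deriv[OF t] t] sym\<Sigma>[OF t] t show ?thesis
    by (simp add: W_def transpose_add matrix_transpose_mul matrix_mul_assoc transpose_outer_prod)
qed

text \<open>Sufficiency is immediate from the first variation formula. For necessity, fields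
  \<open>(t - a) (b - t) (e, B)\<close> on all intervals show that \<open>2 (e \<bullet> P1 t) + tr (B W t)\<close>
  vanishes at each time \<open>t\<close> for all constant \<open>e\<close> and symmetric \<open>B\<close>; then \<open>e = P1 t\<close> and \<open>B = W t\<close> are
  inserted.\<close>

lemma geodesic_iff_Euler_Lagrange:
  assumes sm: "smooth_on I (\<lambda>t. (\<mu> t, \<Sigma> t))"
  shows "geodesic_on gaussian_manifold fisher_sqnorm I (\<lambda>t. (\<mu> t, \<Sigma> t)) \<longleftrightarrow> (\<forall>t\<in>I. P1 t = 0 \<and> W t = 0)"
    (is "?G \<longleftrightarrow> ?EL")
proof -
  have fv: "((\<lambda>s. energy fisher_sqnorm a b (\<lambda>t. \<Gamma> (s, t))) has_real_derivative
      - integral {a..b} (\<lambda>t. 2 * (fst (vector_derivative (\<lambda>s. \<Gamma> (s, t)) (at 0)) \<bullet> P1 t) +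
          trace (snd (vector_derivative (\<lambda>s. \<Gamma> (s, t)) (at 0)) ** W t))) (at 0)"
    if ab: "a < b" "{a..b} \<subseteq> I" and \<epsilon>: "\<epsilon> > 0"
      and v: "proper_variation gaussian_manifold a b (\<lambda>t. (\<mu> t, \<Sigma> t)) \<epsilon> \<Gamma>" for a b \<epsilon> \<Gamma>
  proof -
    have sub: "(f has_vector_derivative f' t) (at t within {a..b})"
      if "\<And>t. t \<in> I \<Longrightarrow> (f has_vector_derivative f' t) (at t within I)" "t \<in> {a..b}"
      for f f' :: "real \<Rightarrow> 'z::real_normed_vector" and t
      using that ab(2) by (blast intro: has_vector_derivative_within_subset)
    show ?thesis
      unfolding W_def
      by (rule first_variation[OF ab(1) \<epsilon> v sub[OF \<mu>1] sub[OF \<Sigma>1] P_def[unfolded X_def] sub[OF P_deriv]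
            Q_def[unfolded X_def] sub[OF Q_deriv] refl])
  qed
  show ?thesis
  proof
    assume EL: ?EL
    have "energy_critical gaussian_manifold fisher_sqnorm a b (\<lambda>t. (\<mu> t, \<Sigma> t))"
      if ab: "a < b" "{a..b} \<subseteq> I" for a b
      unfolding energy_critical_def
    proof (intro allI impI)
      fix \<epsilon> :: real and \<Gamma> assume "\<epsilon> > 0" "proper_variation gaussian_manifold a b (\<lambda>t. (\<mu> t, \<Sigma> t)) \<epsilon> \<Gamma>"
      note fv[OF ab this]
      moreover have "integral {a..b} (\<lambda>t. 2 * (fst (vector_derivative (\<lambda>s. \<Gamma> (s, t)) (at 0)) \<bullet> P1 t) +
          trace (snd (vector_derivative (\<lambda>s. \<Gamma> (s, t)) (at 0)) ** W t)) = integral {a..b} (\<lambda>t. 0)"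
        by (intro integral_cong) (use EL ab in \<open>auto simp: mm.zero_right subset_iff tr.zero\<close>)
      ultimately show "((\<lambda>s. energy fisher_sqnorm a b (\<lambda>t. \<Gamma> (s, t))) has_real_derivative 0) (at 0)"
        by simp
    qed
    then show ?G unfolding geodesic_on_def using sm pd by (auto simp: gaussian_manifold_def)
  next
    assume G: ?G
    have test: "2 * (e \<bullet> P1 t) + trace (B ** W t) = 0" if B: "transpose B = B" and t: "t \<in> I" for e B t
    proof (rule fundamental_lemma_quadratic_weights[OF interval nondegenerate _ _ t])
      show "continuous_on I (\<lambda>t. 2 * (e \<bullet> P1 t) + trace (B ** W t))"
        by (intro continuous_intros mm.continuous_on tr.continuous_on cont_P1 cont_W)
      fix a b :: real assume ab: "a < b" "{a..b} \<subseteq> I"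
      let ?\<Gamma> = "\<lambda>x. (\<mu> (snd x), \<Sigma> (snd x)) + (fst x * ((snd x - a) * (b - snd x))) *\<^sub>R (e, B)"
      have "smooth_on {a..b} (\<lambda>t. (\<mu> t, \<Sigma> t))"
        using sm ab(2) unfolding smooth_on_def by (blast intro: Ck_on_subset)
      then obtain \<epsilon> where \<epsilon>: "\<epsilon> > 0" "proper_variation gaussian_manifold a b (\<lambda>t. (\<mu> t, \<Sigma> t)) \<epsilon> ?\<Gamma>"
        using linear_variation_proper[OF ab(1) _ _ B, of \<mu> \<Sigma>] pd ab(2) by blast
      have "((\<lambda>s. ?\<Gamma> (s, t)) has_vector_derivative ((t - a) * (b - t)) *\<^sub>R (e, B)) (at 0)" for t
        unfolding fst_conv snd_conv has_vector_derivative_def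
        by (auto intro!: derivative_eq_intros)
      then have vd: "vector_derivative (\<lambda>s. ?\<Gamma> (s, t)) (at 0) = ((t - a) * (b - t)) *\<^sub>R (e, B)" for t
        by (rule vector_derivative_at)
      have "((\<lambda>s. energy fisher_sqnorm a b (\<lambda>t. ?\<Gamma> (s, t))) has_real_derivative 0) (at 0)"
        using G ab \<epsilon> unfolding geodesic_on_def energy_critical_def by blast
      from DERIV_unique[OF fv[OF ab \<epsilon>] this]
      have "integral {a..b} (\<lambda>t. 2 * ((((t - a) * (b - t)) *\<^sub>R e) \<bullet> P1 t) +
          trace ((((t - a) * (b - t)) *\<^sub>R B) ** W t)) = 0"
        unfolding vd by simp
      moreover have "2 * ((c *\<^sub>R e) \<bullet> P1 t) + trace ((c *\<^sub>R B) ** W t) = c * (2 * (e \<bullet> P1 t) + trace (B ** W t))" for c t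
        by (simp add: mm.scaleR_left tr.scaleR distrib_left)
      ultimately show "integral {a..b} (\<lambda>t. (t - a) * (b - t) * (2 * (e \<bullet> P1 t) + trace (B ** W t))) = 0"
        by simp
    qed
    show ?EL
    proof (intro ballI conjI)
      fix t assume t: "t \<in> I"
      show "P1 t = 0" using test[OF _ t, of 0 "P1 t"] linear_0[OF bounded_linear.linear[OF bounded_linear_transpose]]
        by (simp add: mm.zero_left tr.zero)
      show "W t = 0" using test[OF transpose_W[OF t] t, of 0] trace_mult_transpose[of "W t"] transpose_W[OF t] by simp
    qed
  qed
qed

text \<open>The Euler--Lagrange equations state that \<open>P\<close> and \<open>K = Q \<Sigma> + P \<mu>\<^sup>T\<close> have derivative zero, since
  \<open>K' = W \<Sigma> + P' \<mu>\<^sup>T\<close> and \<open>\<Sigma>\<close> is invertible. The first order system is the same statement in the form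
  \<open>P = P(t0)\<close>, \<open>K = K(t0)\<close>, solved for the velocities.\<close>

lemma Euler_Lagrange_iff_first_order:
  assumes t0: "t0 \<in> I" and Jmu: "J\<^sub>\<mu> = X t0 *v \<mu>1 t0"
    and JSigma: "J\<^sub>\<Sigma> = X t0 ** (outer_prod (\<mu>1 t0) (\<mu> t0) + \<Sigma>1 t0)"
  shows "(\<forall>t\<in>I. P1 t = 0 \<and> W t = 0) \<longleftrightarrow>
    (\<forall>t\<in>I. \<mu>1 t = \<Sigma> t *v J\<^sub>\<mu> \<and> \<Sigma>1 t = \<Sigma> t ** (J\<^sub>\<Sigma> - outer_prod J\<^sub>\<mu> (\<mu> t)))"
    (is "?EL \<longleftrightarrow> ?FO")
proof -
  define K where "K t = Q t ** \<Sigma> t + outer_prod (P t) (\<mu> t)" for t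
  have mu: "\<mu>1 t = \<Sigma> t *v P t" if "t \<in> I" for t
    by (simp add: P_def matrix_vector_mul_assoc X_\<Sigma> that)
  have Sig: "\<Sigma>1 t = \<Sigma> t ** (Q t ** \<Sigma> t)" if "t \<in> I" for t
    by (simp add: Q_def X_\<Sigma> that flip: matrix_mul_assoc) (simp add: matrix_mul_assoc X_\<Sigma> that)
  have QS: "Q t ** \<Sigma> t = X t ** \<Sigma>1 t" if "t \<in> I" for t
    by (simp add: Q_def X_\<Sigma> that flip: matrix_mul_assoc)
  have P0: "P t0 = J\<^sub>\<mu>" by (simp add: P_def Jmu)
  have K0: "K t0 = J\<^sub>\<Sigma>"
    by (simp add: K_def QS[OF t0] JSigma mm.add_right mult_outer_prod P_def)
  have K_deriv: "(K has_vector_derivative W t ** \<Sigma> t + outer_prod (P1 t) (\<mu> t)) (at t within I)" if t: "t \<in> I" for t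
  proof -
    have "outer_prod (P t) (\<mu>1 t) = outer_prod (P t) (P t) ** \<Sigma> t"
      using mu[OF t] pd[OF t] by (metis outer_prod_mult sym_posdef_def transpose_matrix_vector)
    moreover have "Q t ** \<Sigma>1 t = Q t ** \<Sigma> t ** Q t ** \<Sigma> t"
      by (simp add: Sig[OF t] matrix_mul_assoc)
    ultimately have "Q t ** \<Sigma>1 t + Q1 t ** \<Sigma> t + (outer_prod (P t) (\<mu>1 t) + outer_prod (P1 t) (\<mu> t))
      = W t ** \<Sigma> t + outer_prod (P1 t) (\<mu> t)"
      by (simp add: W_def mm.add_left)
    moreover have "(K has_vector_derivative Q t ** \<Sigma>1 t + Q1 t ** \<Sigma> t + (outer_prod (P t) (\<mu>1 t) + outer_prod (P1 t) (\<mu> t)))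
       (at t within I)"
      unfolding K_def[abs_def]
      by (intro has_vector_derivative_add mm.has_vector_derivative op.has_vector_derivative Q_deriv \<Sigma>1 \<mu>1 P_deriv t)
    ultimately show ?thesis by (simp only:)
  qed
  show ?thesis
  proof
    assume EL: ?EL
    have cI: "convex I" using interval by (simp add: is_interval_convex_1)
    obtain c where c: "\<And>t. t \<in> I \<Longrightarrow> P t = c"
      using has_vector_derivative_zero_constant[OF cI, of P] P_deriv EL by metis
    have P: "P t = J\<^sub>\<mu>" if "t \<in> I" for t using c[OF that] c[OF t0] P0 by simp
    have "(K has_vector_derivative 0) (at t within I)" if "t \<in> I" for t
      using K_deriv[OF that] EL that by (simp add: mm.zero_left op.zero_left)
    then obtain d where d: "\<And>t. t \<in> I \<Longrightarrow> K t = d"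
      using has_vector_derivative_zero_constant[OF cI, of K] by metis
    have K: "K t = J\<^sub>\<Sigma>" if "t \<in> I" for t using d[OF that] d[OF t0] K0 by simp
    show ?FO
    proof (intro ballI conjI)
      fix t assume t: "t \<in> I"
      show "\<mu>1 t = \<Sigma> t *v J\<^sub>\<mu>" using mu[OF t] P[OF t] by simp
      have "Q t ** \<Sigma> t = J\<^sub>\<Sigma> - outer_prod J\<^sub>\<mu> (\<mu> t)"
        using K[OF t] P[OF t] by (simp add: K_def algebra_simps)
      then show "\<Sigma>1 t = \<Sigma> t ** (J\<^sub>\<Sigma> - outer_prod J\<^sub>\<mu> (\<mu> t))" using Sig[OF t] by simp
    qed
  next
    assume FO: ?FO
    have P: "P t = J\<^sub>\<mu>" if "t \<in> I" for t
      using FO that by (simp add: P_def matrix_vector_mul_assoc X_\<Sigma>)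
    have K: "K t = J\<^sub>\<Sigma>" if "t \<in> I" for t
      using FO that by (simp add: K_def QS P matrix_mul_assoc X_\<Sigma>)
    show ?EL
    proof
      fix t assume t: "t \<in> I"
      have "(P has_vector_derivative 0) (at t within I)" "(K has_vector_derivative 0) (at t within I)"
        using has_vector_derivative_transform[OF t P has_vector_derivative_const]
          has_vector_derivative_transform[OF t K has_vector_derivative_const] by auto
      note this[THEN vector_derivative_unique_within[OF nontrivial[OF t], rotated]]
      from this(1)[OF P_deriv[OF t]] this(2)[OF K_deriv[OF t]]
      have P1: "P1 t = 0" and WS: "W t ** \<Sigma> t = 0" by (simp_all add: op.zero_left)
      have "W t = W t ** \<Sigma> t ** X t" by (simp add: X_\<Sigma> t flip: matrix_mul_assoc)
      then have "W t = 0" by (simp add: WS mm.zero_left)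
      with P1 show "P1 t = 0 \<and> W t = 0" by simp
    qed
  qed
qed

end

theorem theorem19:
  fixes I :: "real set" and \<mu> :: "real \<Rightarrow> real^'d" and \<Sigma> :: "real \<Rightarrow> real^'d^'d"
  assumes "is_interval I" and "0 \<in> I" and "I \<noteq> {0}"
    and "smooth_on I \<mu>" and "smooth_on I \<Sigma>"
    and "\<And>t. t \<in> I \<Longrightarrow> sym_posdef (\<Sigma> t)"
  shows "geodesic_on gaussian_manifold fisher_sqnorm I (\<lambda>t. (\<mu> t, \<Sigma> t)) \<longleftrightarrow>
    (let \<mu>' = (\<lambda>t. vector_derivative \<mu> (at t within I));
         \<Sigma>' = (\<lambda>t. vector_derivative \<Sigma> (at t within I));
         J\<^sub>\<mu> = matrix_inv (\<Sigma> 0) *v \<mu>' 0;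
         J\<^sub>\<Sigma> = matrix_inv (\<Sigma> 0) ** (outer_prod (\<mu>' 0) (\<mu> 0) + \<Sigma>' 0)
     in \<forall>t\<in>I. \<mu>' t = \<Sigma> t *v J\<^sub>\<mu> \<and>
              \<Sigma>' t = \<Sigma> t ** (J\<^sub>\<Sigma> - outer_prod J\<^sub>\<mu> (\<mu> t)) \<and>
              \<Sigma> t ** (J\<^sub>\<Sigma> - outer_prod J\<^sub>\<mu> (\<mu> t)) = \<Sigma> t ** J\<^sub>\<Sigma> - outer_prod (\<mu>' t) (\<mu> t))"
proof -
  obtain \<mu>1 where \<mu>1: "\<And>t. t \<in> I \<Longrightarrow> (\<mu> has_vector_derivative \<mu>1 t) (at t within I)" "Ck_on (Suc 0) I \<mu>1"
    using Ck_on_Suc_real_imp_vector_derivative[OF smooth_on_imp_Ck_on[OF assms(4), of "Suc (Suc 0)"]] by blast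
  obtain \<mu>2 where \<mu>2: "\<And>t. t \<in> I \<Longrightarrow> (\<mu>1 has_vector_derivative \<mu>2 t) (at t within I)" "Ck_on 0 I \<mu>2"
    using Ck_on_Suc_real_imp_vector_derivative[OF \<mu>1(2)] by blast
  obtain \<Sigma>1 where \<Sigma>1: "\<And>t. t \<in> I \<Longrightarrow> (\<Sigma> has_vector_derivative \<Sigma>1 t) (at t within I)" "Ck_on (Suc 0) I \<Sigma>1"
    using Ck_on_Suc_real_imp_vector_derivative[OF smooth_on_imp_Ck_on[OF assms(5), of "Suc (Suc 0)"]] by blast
  obtain \<Sigma>2 where \<Sigma>2: "\<And>t. t \<in> I \<Longrightarrow> (\<Sigma>1 has_vector_derivative \<Sigma>2 t) (at t within I)" "Ck_on 0 I \<Sigma>2"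
    using Ck_on_Suc_real_imp_vector_derivative[OF \<Sigma>1(2)] by blast
  interpret gaussian_curve I \<mu> \<mu>1 \<mu>2 \<Sigma> \<Sigma>1 \<Sigma>2
    using assms \<mu>1(1) \<mu>2 \<Sigma>1(1) \<Sigma>2 by unfold_locales auto
  have vd: "vector_derivative \<mu> (at t within I) = \<mu>1 t" "vector_derivative \<Sigma> (at t within I) = \<Sigma>1 t"
    if "t \<in> I" for t
    using vector_derivative_unique_within[OF nontrivial[OF that]] \<mu>1(1)[OF that] \<Sigma>1(1)[OF that]
      vector_derivative_works[THEN iffD1, OF differentiableI_vector] by blast+
  define J\<^sub>\<mu> where "J\<^sub>\<mu> = X 0 *v \<mu>1 0"
  define J\<^sub>\<Sigma> where "J\<^sub>\<Sigma> = X 0 ** (outer_prod (\<mu>1 0) (\<mu> 0) + \<Sigma>1 0)"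
  have eq: "\<Sigma> t ** (J\<^sub>\<Sigma> - outer_prod J\<^sub>\<mu> (\<mu> t)) = \<Sigma> t ** J\<^sub>\<Sigma> - outer_prod (\<mu>1 t) (\<mu> t)"
    if "\<mu>1 t = \<Sigma> t *v J\<^sub>\<mu>" for t
    by (simp add: that bounded_bilinear.diff_right[OF bounded_bilinear_matrix_matrix_mult] mult_outer_prod)
  have "smooth_on I (\<lambda>t. (\<mu> t, \<Sigma> t))"
    using assms(4,5) by (simp add: smooth_on_def Ck_on_Pair)
  then have "geodesic_on gaussian_manifold fisher_sqnorm I (\<lambda>t. (\<mu> t, \<Sigma> t)) \<longleftrightarrow>
     (\<forall>t\<in>I. \<mu>1 t = \<Sigma> t *v J\<^sub>\<mu> \<and> \<Sigma>1 t = \<Sigma> t ** (J\<^sub>\<Sigma> - outer_prod J\<^sub>\<mu> (\<mu> t)))"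
    by (simp only: geodesic_iff_Euler_Lagrange Euler_Lagrange_iff_first_order[OF assms(2) J\<^sub>\<mu>_def J\<^sub>\<Sigma>_def])
  also have "\<dots> \<longleftrightarrow> (\<forall>t\<in>I. \<mu>1 t = \<Sigma> t *v J\<^sub>\<mu> \<and> \<Sigma>1 t = \<Sigma> t ** (J\<^sub>\<Sigma> - outer_prod J\<^sub>\<mu> (\<mu> t)) \<and>
      \<Sigma> t ** (J\<^sub>\<Sigma> - outer_prod J\<^sub>\<mu> (\<mu> t)) = \<Sigma> t ** J\<^sub>\<Sigma> - outer_prod (\<mu>1 t) (\<mu> t))"
    using eq by blast
  finally show ?thesis
    unfolding Let_def vd[OF assms(2)] X_def[of 0, symmetric] J\<^sub>\<mu>_def[symmetric] J\<^sub>\<Sigma>_def[symmetric]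
    by (simp only: vd cong: ball_cong)
qed

end
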